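(* Let $s\ge1$, $k\ge1$ be integers and $0<\lambda<2^s$ an integer. Write $\lambda=2^r\lambda'$ with $0\le r<s$ and $\lambda'$ odd. Then $$\rho_{k,\lambda}(2^s)=\sum_{i=0}^{\lfloor r/2\rfloor-1}\Big(2^{ki}2^{(s-2i-3)(k-1)}\cdot\rho^{(1)}_{k,\lambda/2^{2i}}(8)\Big)+2^{k\lfloor r/2\rfloor}\rho^{(1)}_{k,\lambda/2^{2\lfloor r/2\rfloor}}\big(2^{s-2\lfloor r/2\rfloor}\big),$$ where the sum is empty (equal to $0$) when its upper limit is $-1$.
   Context: For positive integers $k,n$ and an integer $\mu$, $\rho_{k,\mu}(n)$ is the number of $(x_1,\dots,x_k)\in(\mathbb{Z}/n\mathbb{Z})^k$ with $x_1^2+\cdots+x_k^2\equiv\mu\pmod n$. For integers $t\ge1$ and $\mu$, $\rho^{(1)}_{k,\mu}(2^t)$ is the number of $(x_1,\dots,x_k)\in(\mathbb{Z}/2^t\mathbb{Z})^k$ with $x_1^2+\cdots+x_k^2\equiv\mu\pmod{2^t}$ and $x_i$ odd for at least one $i$. *)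

theory Defs
  imports "HOL-Number_Theory.Cong" "HOL-Library.FuncSet"
begin

text \<open>
  Elements of $(\mathbb{Z}/n\mathbb{Z})^k$ are represented by the extensional functions from
  the index set \<open>{..<k}\<close> to the least non-negative residues \<open>{0..<n}\<close>.
\<close>

definition rho :: "nat \<Rightarrow> int \<Rightarrow> nat \<Rightarrow> nat" where
  "rho k \<mu> n =
     card {x \<in> {..<k} \<rightarrow>\<^sub>E {0..<int n}. [(\<Sum>i<k. (x i)\<^sup>2) = \<mu>] (mod int n)}"

text \<open>
  The parity of a residue class is independent of the chosen representative only for even
  moduli; the following count is meant for moduli \<open>n = 2 ^ t\<close> with \<open>t \<ge> 1\<close>.
\<close>

definition rho1 :: "nat \<Rightarrow> int \<Rightarrow> nat \<Rightarrow> nat" where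
  "rho1 k \<mu> n =
     card {x \<in> {..<k} \<rightarrow>\<^sub>E {0..<int n}.
             [(\<Sum>i<k. (x i)\<^sup>2) = \<mu>] (mod int n) \<and> (\<exists>i<k. odd (x i))}"

end

theory Submission
  imports Defs
begin

text \<open>
  A solution modulo \<open>2 ^ s\<close> with all coordinates even has the form \<open>x = 2 y\<close>, where \<open>y\<close> is determined modulo \<open>2 ^ (s - 1)\<close>
  and solves the equation for \<open>\<mu> / 4\<close> modulo \<open>2 ^ (s - 2)\<close>; this gives the recursion in \<open>s\<close>.
  For solutions with an odd coordinate, adding \<open>2 ^ (t - 1)\<close> to the first odd coordinate changes
  the sum of squares by \<open>2 ^ t\<close> modulo \<open>2 ^ (t + 1)\<close> when \<open>t \<ge> 3\<close>, so exactly half of the lifts of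
  the solutions modulo \<open>2 ^ t\<close> are solutions modulo \<open>2 ^ (t + 1)\<close>.
\<close>

section \<open>Counting solutions of conditions that depend only on residues\<close>

text \<open>Division with remainder in every coordinate writes \<open>x i\<close> as
  \<open>y i + int n * z i\<close>: the remainders \<open>y\<close> decide \<open>P\<close>, and the
  quotients \<open>z\<close> range freely over \<open>m\<close> values each. Only
  \<open>m = 2\<close> is needed below, once for halved even solutions and once for lifts.\<close>

lemma card_PiE_periodic:
  fixes n m :: nat and P :: "('a \<Rightarrow> int) \<Rightarrow> bool"
  assumes "finite I" and n: "n > 0"
    and P: "\<And>x y. (\<And>i. i \<in> I \<Longrightarrow> [x i = y i] (mod int n)) \<Longrightarrow> P x \<longleftrightarrow> P y"
  shows "card {x \<in> I \<rightarrow>\<^sub>E {0..<int (m * n)}. P x} = m ^ card I * card {x \<in> I \<rightarrow>\<^sub>E {0..<int n}. P x}"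
proof -
  let ?A = "{x \<in> I \<rightarrow>\<^sub>E {0..<int (m * n)}. P x}"
  let ?B = "{x \<in> I \<rightarrow>\<^sub>E {0..<int n}. P x} \<times> (I \<rightarrow>\<^sub>E {0..<int m})"
  define f :: "('a \<Rightarrow> int) \<Rightarrow> ('a \<Rightarrow> int) \<times> ('a \<Rightarrow> int)"
    where "f = (\<lambda>x. (\<lambda>i\<in>I. x i mod int n, \<lambda>i\<in>I. x i div int n))"
  define g :: "('a \<Rightarrow> int) \<times> ('a \<Rightarrow> int) \<Rightarrow> ('a \<Rightarrow> int)"
    where "g = (\<lambda>(y, z). \<lambda>i\<in>I. y i + int n * z i)"
  have "bij_betw f ?A ?B"
  proof (rule bij_betw_byWitness[where f' = g])
    show "\<forall>x\<in>?A. g (f x) = x"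
      by (auto simp: f_def g_def fun_eq_iff PiE_def extensional_def)
    show "\<forall>y\<in>?B. f (g y) = y"
      using n by (fastforce simp: f_def g_def fun_eq_iff PiE_def extensional_def Pi_def)
    show "f ` ?A \<subseteq> ?B"
    proof (rule image_subsetI)
      fix x assume x: "x \<in> ?A"
      have "x i div int n \<in> {0..<int m}" if "i \<in> I" for i
      proof -
        have *: "x i \<in> {0..<int (m * n)}" using x that by auto
        have "int n * (x i div int n) \<le> x i"
          using n mult_div_mod_eq[of "int n" "x i"] pos_mod_sign[of "int n" "x i"] by linarith
        with * have "int n * (x i div int n) < int n * int m"
          by (simp add: mult.commute)
        with * n show ?thesis
          by (auto simp: pos_imp_zdiv_nonneg_iff)
      qed
      moreover have "P (\<lambda>i\<in>I. x i mod int n)"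
        using x by (subst P[of _ x]) (auto simp: cong_def)
      ultimately show "f x \<in> ?B"
        using n by (auto simp: f_def)
    qed
    show "g ` ?B \<subseteq> ?A"
    proof (rule image_subsetI)
      fix w assume "w \<in> ?B"
      then obtain y z where w: "w = (y, z)" and y: "y \<in> I \<rightarrow>\<^sub>E {0..<int n}" "P y"
        and z: "z \<in> I \<rightarrow>\<^sub>E {0..<int m}" by auto
      have "y i + int n * z i \<in> {0..<int (m * n)}" if "i \<in> I" for i
      proof -
        have 1: "0 \<le> y i" "y i < int n" "0 \<le> z i" "z i + 1 \<le> int m" using y z that by force+
        then have "int n * (z i + 1) \<le> int n * int m" by (intro mult_left_mono) auto
        with 1 show ?thesis by (simp add: algebra_simps)
      qed
      moreover have "P (g w)"
        using y by (subst P[of _ y]) (auto simp: w g_def cong_def)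
      ultimately show "g w \<in> ?A"
        by (auto simp: w g_def)
    qed
  qed
  then have "card ?A = card ?B" by (rule bij_betw_same_card)
  then show ?thesis
    using \<open>finite I\<close> by (simp add: card_cartesian_product card_PiE)
qed

lemma cong_sum_squares_periodic:
  fixes x y :: "'a \<Rightarrow> int"
  assumes "\<And>i. i \<in> I \<Longrightarrow> [x i = y i] (mod n)"
  shows "[(\<Sum>i\<in>I. (x i)\<^sup>2) = \<mu>] (mod n) \<longleftrightarrow> [(\<Sum>i\<in>I. (y i)\<^sup>2) = \<mu>] (mod n)"
proof -
  have "[(\<Sum>i\<in>I. (x i)\<^sup>2) = (\<Sum>i\<in>I. (y i)\<^sup>2)] (mod n)"
    by (intro cong_sum cong_pow assms)
  then show ?thesis using cong_trans cong_sym by blast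
qed

section \<open>Solutions with all coordinates even\<close>

lemma rho_split:
  "rho k \<mu> n = rho1 k \<mu> n +
    card {x \<in> {..<k} \<rightarrow>\<^sub>E {0..<int n}. [(\<Sum>i<k. (x i)\<^sup>2) = \<mu>] (mod int n) \<and> (\<forall>i<k. even (x i))}"
proof -
  have "finite ({..<k} \<rightarrow>\<^sub>E {0..<int n})" by (intro finite_PiE) auto
  then show ?thesis
    unfolding rho_def rho1_def
    by (subst card_Un_disjoint[symmetric]) (auto intro!: arg_cong[where f = card])
qed

text \<open>Halving the coordinates leaves representatives modulo \<open>2 * n\<close>, while
  dividing the congruence by 4 leaves a condition modulo \<open>n\<close> only. Each solution modulo
  \<open>n\<close> therefore arises from \<open>2 ^ k\<close> even ones.\<close>

lemma card_even_solutions: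
  fixes n :: nat
  assumes "n > 0"
  shows "card {x \<in> {..<k} \<rightarrow>\<^sub>E {0..<int (4 * n)}.
      [(\<Sum>i<k. (x i)\<^sup>2) = 4 * \<mu>] (mod int (4 * n)) \<and> (\<forall>i<k. even (x i))} = 2 ^ k * rho k \<mu> n"
    (is "card ?A = _")
proof -
  let ?B = "{y \<in> {..<k} \<rightarrow>\<^sub>E {0..<int (2 * n)}. [(\<Sum>i<k. (y i)\<^sup>2) = \<mu>] (mod int n)}"
  define f :: "(nat \<Rightarrow> int) \<Rightarrow> nat \<Rightarrow> int" where "f = (\<lambda>y. \<lambda>i\<in>{..<k}. 2 * y i)"
  define g :: "(nat \<Rightarrow> int) \<Rightarrow> nat \<Rightarrow> int" where "g = (\<lambda>x. \<lambda>i\<in>{..<k}. x i div 2)"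
  have cong4: "[4 * a = 4 * \<mu>] (mod int (4 * n)) \<longleftrightarrow> [a = \<mu>] (mod int n)" for a
  proof -
    have "4 * int n dvd 4 * (a - \<mu>) \<longleftrightarrow> int n dvd a - \<mu>"
      by (subst dvd_mult_cancel_left) simp
    then show ?thesis by (simp add: cong_iff_dvd_diff)
  qed
  have double: "(\<Sum>i<k. (2 * y i)\<^sup>2) = 4 * (\<Sum>i<k. (y i)\<^sup>2)" for y :: "nat \<Rightarrow> int"
    by (simp add: power_mult_distrib sum_distrib_left)
  have "bij_betw f ?B ?A"
  proof (rule bij_betw_byWitness[where f' = g])
    show "\<forall>y\<in>?B. g (f y) = y"
      by (auto simp: f_def g_def fun_eq_iff PiE_def extensional_def)
    show "\<forall>x\<in>?A. f (g x) = x"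
      by (auto simp: f_def g_def fun_eq_iff PiE_def extensional_def)
    show "f ` ?B \<subseteq> ?A"
    proof (rule image_subsetI)
      fix y assume y: "y \<in> ?B"
      have "(\<Sum>i<k. (f y i)\<^sup>2) = 4 * (\<Sum>i<k. (y i)\<^sup>2)"
        by (simp add: f_def flip: double)
      moreover have "f y \<in> {..<k} \<rightarrow>\<^sub>E {0..<int (4 * n)}"
        using y by (fastforce simp: f_def)
      ultimately show "f y \<in> ?A" using y cong4 by (simp add: f_def)
    qed
    show "g ` ?A \<subseteq> ?B"
    proof (rule image_subsetI)
      fix x assume x: "x \<in> ?A"
      have "(\<Sum>i<k. (x i)\<^sup>2) = 4 * (\<Sum>i<k. (g x i)\<^sup>2)"
        using x by (simp add: g_def flip: double)
      moreover have "g x \<in> {..<k} \<rightarrow>\<^sub>E {0..<int (2 * n)}"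
        using x by (fastforce simp: g_def)
      ultimately show "g x \<in> ?B" using x cong4 by simp
    qed
  qed
  then have "card ?A = card ?B" by (rule bij_betw_same_card[symmetric])
  also have "\<dots> = 2 ^ k * rho k \<mu> n"
    unfolding rho_def
    by (subst card_PiE_periodic[OF _ assms]) (auto intro!: cong_sum_squares_periodic)
  finally show ?thesis .
qed

lemma rho_step:
  assumes "n > 0"
  shows "rho k (4 * \<mu>) (4 * n) = rho1 k (4 * \<mu>) (4 * n) + 2 ^ k * rho k \<mu> n"
  using rho_split[of k "4 * \<mu>" "4 * n"] card_even_solutions[OF assms, of k \<mu>] by simp

text \<open>A sum of even squares is divisible by 4, so an all-even solution would force
  \<open>d\<close> to divide \<open>\<mu>\<close>. The choices \<open>d = 2\<close> and
  \<open>d = 4\<close> serve the exponents \<open>r = 0\<close> and \<open>r = 1\<close>.\<close>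

lemma rho_eq_rho1:
  assumes "d dvd n" "d dvd 4" "\<not> int d dvd \<mu>"
  shows "rho k \<mu> n = rho1 k \<mu> n"
proof -
  have False if "[(\<Sum>i<k. (x i)\<^sup>2) = \<mu>] (mod int n)" "\<forall>i<k. even (x i)" for x :: "nat \<Rightarrow> int"
  proof -
    have "int d dvd (x i)\<^sup>2" if "i < k" for i
    proof -
      have "2 ^ 2 dvd (x i)\<^sup>2" using that \<open>\<forall>i<k. even (x i)\<close> by (intro dvd_power_same) auto
      moreover have "int d dvd 4" using \<open>d dvd 4\<close> by presburger
      ultimately show ?thesis by (auto intro: dvd_trans)
    qed
    then have "int d dvd (\<Sum>i<k. (x i)\<^sup>2)" by (intro dvd_sum) auto
    moreover have "[(\<Sum>i<k. (x i)\<^sup>2) = \<mu>] (mod int d)"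
      using that(1) assms(1) by (meson cong_dvd_modulus of_nat_dvd_iff)
    ultimately show False using assms(3) by (simp add: cong_dvd_iff)
  qed
  then show ?thesis unfolding rho_split by (subst card_eq_0_iff[THEN iffD2]) auto
qed

section \<open>Lifting solutions with an odd coordinate\<close>

lemma rho1_step:
  assumes t: "t \<ge> 3" and k: "k \<ge> 1"
  shows "rho1 k \<mu> (2 ^ Suc t) = 2 ^ (k - 1) * rho1 k \<mu> (2 ^ t)"
proof -
  define N :: int where "N = 2 ^ Suc t"
  define h :: int where "h = 2 ^ (t - 1)"
  \<comment> \<open>\<open>Q\<close> asks for the congruence modulo \<open>2 ^ t\<close> only, so
    \<open>S\<close> consists of all lifts to residues modulo \<open>2 ^ Suc t\<close>, and
    \<open>A\<close> of those lifts that are still solutions.\<close>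
  define Q where "Q x \<longleftrightarrow> [(\<Sum>i<k. (x i)\<^sup>2) = \<mu>] (mod 2 ^ t) \<and> (\<exists>i<k. odd (x i))"
    for x :: "nat \<Rightarrow> int"
  define S where "S = {x \<in> {..<k} \<rightarrow>\<^sub>E {0..<N}. Q x}"
  define A where "A = {x \<in> S. [(\<Sum>i<k. (x i)\<^sup>2) = \<mu>] (mod N)}"
  \<comment> \<open>The choice depends on parities alone. As \<open>h\<close> and \<open>N\<close>
    are even, \<open>T\<close> preserves parities and hence the chosen index.\<close>
  define j where "j x = (LEAST i. i < k \<and> odd (x i))" for x :: "nat \<Rightarrow> int"
  define T where "T x = x(j x := (x (j x) + h) mod N)" for x :: "nat \<Rightarrow> int"
  have N: "N > 0" "N = 2 * 2 ^ t" "even N" by (auto simp: N_def)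
  have h: "even h" "2 * h = 2 ^ t"
    using t by (cases t; simp add: h_def)+
  \<comment> \<open>This is where \<open>t \<ge> 3\<close> enters:
    \<open>2 * (t - 1) \<ge> t + 1\<close>.\<close>
  have "N dvd h\<^sup>2"
    using t unfolding N_def h_def power_mult[symmetric] by (intro le_imp_power_dvd) linarith
  have finS: "finite S"
    by (rule finite_subset[of _ "{..<k} \<rightarrow>\<^sub>E {0..<N}"]) (auto simp: S_def intro: finite_PiE)
  \<comment> \<open>Since \<open>a - \<mu>\<close> is a multiple of \<open>2 ^ t\<close>, which is
    half of \<open>N\<close>, exactly one of \<open>a\<close> and \<open>a + 2 ^ t\<close> is
    congruent to \<open>\<mu>\<close>.\<close>
  have N_cases: "[a = \<mu>] (mod N) \<longleftrightarrow> \<not> [a + 2 ^ t = \<mu>] (mod N)" if a: "[a = \<mu>] (mod 2 ^ t)" for a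
  proof -
    obtain c where c: "a - \<mu> = 2 ^ t * c" using a by (auto simp: cong_iff_dvd_diff elim: dvdE)
    then have "a + 2 ^ t - \<mu> = 2 ^ t * (c + 1)" by (simp add: algebra_simps)
    moreover have "N dvd 2 ^ t * d \<longleftrightarrow> even d" for d
      unfolding N(2) mult.commute[of 2] by (subst dvd_mult_cancel_left) simp
    ultimately show ?thesis using c by (simp add: cong_iff_dvd_diff)
  qed
  have j: "j x < k" "odd (x (j x))" if "x \<in> S" for x
    using that LeastI_ex[of "\<lambda>i. i < k \<and> odd (x i)"] by (auto simp: S_def Q_def j_def)
  have odd_T: "odd (T x i) \<longleftrightarrow> odd (x i)" for x i
    using h(1) N(3) by (auto simp: T_def dvd_mod_iff)
  have j_T: "j (T x) = j x" for x by (simp add: j_def odd_T)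
  have sum_T: "[(\<Sum>i<k. (T x i)\<^sup>2) = (\<Sum>i<k. (x i)\<^sup>2) + 2 ^ t] (mod N)" if x: "x \<in> S" for x
  proof -
    have sum_diff_j: "(\<Sum>i<k. (z i)\<^sup>2) = (z (j x))\<^sup>2 + (\<Sum>i\<in>{..<k} - {j x}. (z i)\<^sup>2)"
      for z :: "nat \<Rightarrow> int" using j[OF x] by (intro sum.remove) auto
    obtain c where c: "x (j x) = 2 * c + 1" using j[OF x] by (auto elim: oddE)
    have "[((x (j x) + h) mod N)\<^sup>2 = (x (j x) + h)\<^sup>2] (mod N)" by (simp add: cong_def power_mod)
    \<comment> \<open>The cross term is \<open>2 * h * (2 * c + 1) = 2 ^ t + N * c\<close>; oddness
      of the coordinate leaves exactly one \<open>2 ^ t\<close>.\<close>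
    also have "(x (j x) + h)\<^sup>2 = (x (j x))\<^sup>2 + 2 ^ t + (N * c + h\<^sup>2)"
      by (simp add: N(2) c power2_eq_square algebra_simps flip: h(2))
    also have "[(x (j x))\<^sup>2 + 2 ^ t + (N * c + h\<^sup>2) = (x (j x))\<^sup>2 + 2 ^ t] (mod N)"
      using \<open>N dvd h\<^sup>2\<close> by (simp add: cong_iff_dvd_diff)
    finally have "[(T x (j x))\<^sup>2 = (x (j x))\<^sup>2 + 2 ^ t] (mod N)" by (simp add: T_def)
    moreover have "(\<Sum>i\<in>{..<k} - {j x}. (T x i)\<^sup>2) = (\<Sum>i\<in>{..<k} - {j x}. (x i)\<^sup>2)"
      by (intro sum.cong) (auto simp: T_def)
    ultimately show ?thesis
      unfolding sum_diff_j[of x] sum_diff_j[of "T x"]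
      by (smt (verit) cong_add_rcancel)
  qed
  have T_S: "T x \<in> S" if x: "x \<in> S" for x
  proof -
    have "[(\<Sum>i<k. (T x i)\<^sup>2) = (\<Sum>i<k. (x i)\<^sup>2) + 2 ^ t] (mod 2 ^ t)"
      using sum_T[OF x] by (rule cong_dvd_modulus) (simp add: N(2))
    then have "[(\<Sum>i<k. (T x i)\<^sup>2) = \<mu>] (mod 2 ^ t)"
      using x by (simp add: S_def Q_def cong_def)
    then have "Q (T x)" using x by (simp add: S_def Q_def odd_T)
    moreover have "T x \<in> {..<k} \<rightarrow>\<^sub>E {0..<N}"
      using x j[OF x] N by (auto simp: S_def T_def PiE_def extensional_def)
    ultimately show ?thesis by (simp add: S_def)
  qed
  have T_A: "T x \<in> A \<longleftrightarrow> x \<notin> A" if x: "x \<in> S" for x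
  proof -
    have *: "[(\<Sum>i<k. (x i)\<^sup>2) = \<mu>] (mod 2 ^ t)" using x by (simp add: S_def Q_def)
    have "T x \<in> A \<longleftrightarrow> [(\<Sum>i<k. (x i)\<^sup>2) + 2 ^ t = \<mu>] (mod N)"
      using sum_T[OF x] T_S[OF x] by (simp add: A_def cong_def)
    then show ?thesis using N_cases[OF *] x by (simp add: A_def)
  qed
  have inj: "inj_on T S"
  proof (rule inj_onI)
    fix x y assume xy: "x \<in> S" "y \<in> S" "T x = T y"
    then have jj: "j x = j y" using j_T by metis
    show "x = y"
    proof
      fix i
      show "x i = y i"
      proof (cases "i = j x")
        case True
        have "[x i + h = y i + h] (mod N)"
          using fun_cong[OF xy(3), of i] by (simp add: T_def jj True cong_def)
        then have "[x i = y i] (mod N)" by (simp add: cong_add_rcancel)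
        moreover have "x i \<in> {0..<N}" "y i \<in> {0..<N}"
          using xy j(1)[OF xy(1)] unfolding True S_def by (blast dest: PiE_mem)+
        ultimately show ?thesis by (simp add: cong_def)
      next
        case False
        then show ?thesis using fun_cong[OF xy(3), of i] by (simp add: T_def flip: jj)
      qed
    qed
  qed
  have AS: "A \<subseteq> S" by (auto simp: A_def)
  \<comment> \<open>\<open>T\<close> maps \<open>A\<close> into \<open>S - A\<close> and
    \<open>S - A\<close> into \<open>A\<close>, injectively both times, so the two have equal
    size.\<close>
  have "card A \<le> card (S - A)"
  proof (rule card_inj_on_le[of T])
    show "inj_on T A" using inj AS by (rule inj_on_subset)
    show "T ` A \<subseteq> S - A" using AS T_A T_S by blast
  qed (use finS in simp)
  moreover have "card (S - A) \<le> card A"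
  proof (rule card_inj_on_le[of T])
    show "inj_on T (S - A)" using inj by (rule inj_on_subset) blast
    show "T ` (S - A) \<subseteq> A" using T_A by blast
  qed (rule finite_subset[OF AS finS])
  moreover have "card S = card A + card (S - A)"
    using AS finS by (metis card_Diff_subset card_mono finite_subset le_add_diff_inverse)
  ultimately have "card S = 2 * card A" by linarith
  moreover have "card S = 2 ^ k * rho1 k \<mu> (2 ^ t)"
  proof -
    have "Q x \<longleftrightarrow> Q y" if xy: "\<And>i. i \<in> {..<k} \<Longrightarrow> [x i = y i] (mod int (2 ^ t))" for x y
    proof -
      have "odd (x i) \<longleftrightarrow> odd (y i)" if "i < k" for i
      proof -
        have "[x i = y i] (mod 2)"
          using xy[of i] that t by (auto intro: cong_dvd_modulus)
        then show ?thesis by (metis cong_dvd_iff)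
      qed
      then show ?thesis
        unfolding Q_def using cong_sum_squares_periodic[of "{..<k}" x y "2 ^ t" \<mu>] xy by auto
    qed
    from card_PiE_periodic[of "{..<k}" "2 ^ t" Q 2, OF _ _ this]
    show ?thesis by (simp add: S_def N_def rho1_def Q_def)
  qed
  moreover have "A = {x \<in> {..<k} \<rightarrow>\<^sub>E {0..<int (2 ^ Suc t)}.
      [(\<Sum>i<k. (x i)\<^sup>2) = \<mu>] (mod int (2 ^ Suc t)) \<and> (\<exists>i<k. odd (x i))}"
    by (auto simp: A_def S_def Q_def N_def intro: cong_dvd_modulus)
  then have "card A = rho1 k \<mu> (2 ^ Suc t)" by (simp add: rho1_def)
  ultimately show ?thesis using k by (cases k) auto
qed

lemma rho1_eq_rho1_8:
  assumes "t \<ge> 3" "k \<ge> 1"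
  shows "rho1 k \<mu> (2 ^ t) = 2 ^ ((t - 3) * (k - 1)) * rho1 k \<mu> 8"
  using assms(1)
proof (induction t rule: nat_induct_at_least)
  case (Suc t)
  have "(Suc t - 3) * (k - 1) = (k - 1) + (t - 3) * (k - 1)"
    using Suc.hyps by (simp only: Suc_diff_le mult_Suc)
  then show ?case
    by (simp only: rho1_step[OF Suc.hyps assms(2)] Suc.IH power_add mult.assoc)
qed simp

section \<open>The recursion removing factors of 4\<close>

theorem theorem3:
  fixes s k r :: nat and l l' :: int
  assumes "s \<ge> 1" and "k \<ge> 1"
    and "0 < l" and "l < 2 ^ s"
    and "l = 2 ^ r * l'" and "r < s" and "odd l'"
  shows "rho k l (2 ^ s) =
    (\<Sum>i<r div 2. 2 ^ (k * i) * 2 ^ ((s - 2 * i - 3) * (k - 1)) * rho1 k (l div 2 ^ (2 * i)) 8)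
    + 2 ^ (k * (r div 2)) * rho1 k (l div 2 ^ (2 * (r div 2))) (2 ^ (s - 2 * (r div 2)))"
  using assms(5,6)
\<comment> \<open>Each step divides \<open>l\<close> by 4 and lowers \<open>r\<close> and
  \<open>s\<close> by 2, keeping the odd part \<open>l'\<close> fixed.\<close>
proof (induction "r div 2" arbitrary: l r s)
  case 0
  then have "r = 0 \<or> r = 1" by auto
  then have "rho k l (2 ^ s) = rho1 k l (2 ^ s)"
  proof
    assume "r = 0"
    then show ?thesis using 0 \<open>odd l'\<close> by (intro rho_eq_rho1[of 2]) auto
  next
    assume r: "r = 1"
    \<comment> \<open>From \<open>1 = r < s\<close> follows \<open>s \<ge> 2\<close>, so 4 divides
      the modulus, but it does not divide \<open>2 * l'\<close>.\<close>
    then have "2 ^ 2 dvd (2 ^ s :: nat)" using 0 by (intro le_imp_power_dvd) auto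
    moreover have "\<not> 2 * 2 dvd 2 * l'" using \<open>odd l'\<close> by (subst dvd_mult_cancel_left) auto
    ultimately show ?thesis using 0 r by (intro rho_eq_rho1[of 4]) auto
  qed
  then show ?case using 0 by simp
next
  case (Suc m)
  define r0 s0 l0 where "r0 = r - 2" and "s0 = s - 2" and "l0 = 2 ^ r0 * l'"
  have r: "r = r0 + 2" using Suc.hyps(2) by (simp add: r0_def)
  have s: "s = s0 + 2" using Suc.prems r by (simp add: s0_def)
  have l: "l = 4 * l0" using Suc.prems r by (simp add: l0_def)
  have m: "m = r0 div 2" "r0 < s0" "r div 2 = Suc (r0 div 2)" using Suc r s by auto
  have div4: "l div 2 ^ (2 * Suc i) = l0 div 2 ^ (2 * i)" for i
    by (simp add: l)
  have "rho k l (2 ^ s) = rho1 k l (2 ^ s) + 2 ^ k * rho k l0 (2 ^ s0)"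
    using rho_step[of "2 ^ s0" k l0] by (simp add: l s)
  \<comment> \<open>Here \<open>2 \<le> r < s\<close> gives \<open>s \<ge> 3\<close>, so modulus 8
    is reachable. This is the summand for \<open>i = 0\<close>; the induction hypothesis times
    \<open>2 ^ k\<close> supplies the shifted rest.\<close>
  also have "rho1 k l (2 ^ s) = 2 ^ ((s - 3) * (k - 1)) * rho1 k l 8"
    using m s \<open>k \<ge> 1\<close> by (intro rho1_eq_rho1_8) auto
  also note Suc.hyps(1)[OF m(1) l0_def m(2)]
  finally show ?case
    unfolding m(3) sum.lessThan_Suc_shift div4
    by (simp add: s sum_distrib_left power_add algebra_simps)
qed

end
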